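(* If $\aleph_1<\lambda=\mathrm{cf}(\lambda)<2^{\aleph_0}$, then there is no universal linear order in cardinality $\lambda$.
   Context: A universal linear order in cardinality $\lambda$ is a linear order of cardinality $\lambda$ into which every linear order of cardinality at most $\lambda$ embeds by an order-preserving one-to-one map. *)

theory Defs
  imports Main
begin

unbundle cardinal_syntax

text \<open>
  Linear orders are reflexive relations whose underlying set is their field.  On linear orders, an
  injective map preserving the reflexive order is the same as a map preserving the strict order.
\<close>

definition order_embedding :: "'a rel \<Rightarrow> 'b rel \<Rightarrow> ('a \<Rightarrow> 'b) \<Rightarrow> bool" where
  "order_embedding L U f \<longleftrightarrow>
     f ` Field L \<subseteq> Field U \<and> inj_on f (Field L) \<and> (\<forall>(x, y) \<in> L. (f x, f y) \<in> U)"

text \<open>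
  HOL cannot quantify over types inside a formula.  It loses nothing to let \<open>L\<close> range over the
  orders living on the type that carries the cardinal \<open>\<kappa>\<close>: every linear order of cardinality at
  most \<open>\<kappa>\<close>, on whatever type, has an isomorphic copy there (lemma
  \<open>universal_linear_order_embeds\<close>).
\<close>

definition universal_linear_order :: "'k rel \<Rightarrow> 'u rel \<Rightarrow> bool" where
  "universal_linear_order \<kappa> U \<longleftrightarrow>
     Linear_order U \<and> |Field U| =o \<kappa> \<and>
     (\<forall>L :: 'k rel. Linear_order L \<longrightarrow> |Field L| \<le>o \<kappa> \<longrightarrow> (\<exists>f. order_embedding L U f))"

lemma universal_linear_order_embeds:
  fixes \<kappa> :: "'k rel" and U :: "'u rel" and L :: "'l rel"
  assumes "Card_order \<kappa>" and U: "universal_linear_order \<kappa> U"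
    and L: "Linear_order L" and card: "|Field L| \<le>o \<kappa>"
  shows "\<exists>f. order_embedding L U f"
proof -
  have "|Field L| \<le>o |Field \<kappa>|"
    by (rule ordLeq_ordIso_trans[OF card ordIso_symmetric[OF card_of_Field_ordIso[OF assms(1)]]])
  then obtain g :: "'l \<Rightarrow> 'k" where g: "inj_on g (Field L)"
    unfolding card_of_ordLeq[symmetric] by blast
  define M where "M = map_prod g g ` L"
  have FM: "Field M = g ` Field L"
    unfolding M_def by (simp add: Field_def Domain_fst Range_snd image_comp image_Un)
  have M_iff: "(g x, g y) \<in> M \<longleftrightarrow> (x, y) \<in> L" if "x \<in> Field L" "y \<in> Field L" for x y
  proof
    assume "(g x, g y) \<in> M"
    then obtain u v where uv: "(u, v) \<in> L" "g u = g x" "g v = g y"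
      unfolding M_def by auto
    then have "u = x" "v = y"
      using that FieldI1[OF uv(1)] FieldI2[OF uv(1)] inj_on_eq_iff[OF g] by blast+
    with uv show "(x, y) \<in> L" by simp
  next
    assume "(x, y) \<in> L"
    then show "(g x, g y) \<in> M" unfolding M_def by force
  qed
  have rL: "refl_on (Field L) L" and tL: "trans L" and aL: "antisym L" and toL: "total_on (Field L) L"
    using L by (auto simp: order_on_defs)
  have MD: "\<exists>x \<in> Field L. \<exists>y \<in> Field L. a = g x \<and> b = g y \<and> (x, y) \<in> L" if ab: "(a, b) \<in> M" for a b
  proof -
    obtain x y where "(x, y) \<in> L" "a = g x" "b = g y"
      using ab unfolding M_def by auto
    then show ?thesis using FieldI1[of x y L] FieldI2[of x y L] by blast
  qed
  have "refl_on (Field M) M"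
    using rL M_iff unfolding refl_on_def FM by auto
  moreover have "trans M"
  proof (rule transI)
    fix a b c assume "(a, b) \<in> M" "(b, c) \<in> M"
    then obtain x y y' z where *: "x \<in> Field L" "y \<in> Field L" "y' \<in> Field L" "z \<in> Field L"
      "a = g x" "b = g y" "b = g y'" "c = g z" "(x, y) \<in> L" "(y', z) \<in> L"
      using MD by meson
    have "y = y'"
      by (rule inj_onD[OF g]) (use * in simp_all)
    then have "(x, z) \<in> L" using * transD[OF tL, of x y z] by simp
    then show "(a, c) \<in> M" using * M_iff by simp
  qed
  moreover have "antisym M"
  proof (rule antisymI)
    fix a b assume "(a, b) \<in> M" "(b, a) \<in> M"
    then obtain x y where *: "x \<in> Field L" "y \<in> Field L" "a = g x" "b = g y" "(x, y) \<in> L"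
      using MD by meson
    then have "(y, x) \<in> L" using \<open>(b, a) \<in> M\<close> M_iff by simp
    then show "a = b" using * antisymD[OF aL, of x y] by simp
  qed
  moreover have "total_on (Field M) M"
    using toL M_iff unfolding total_on_def FM by auto
  moreover have "M \<subseteq> Field M \<times> Field M" by (simp add: Field_def subset_iff) blast
  ultimately have "Linear_order M" by (simp add: order_on_defs)
  moreover have "|Field M| \<le>o \<kappa>"
    unfolding FM by (rule ordLeq_transitive[OF card_of_image card])
  ultimately obtain f where f: "order_embedding M U f"
    using U unfolding universal_linear_order_def by blast
  have "inj_on (f \<circ> g) (Field L)"
    using f g comp_inj_on unfolding order_embedding_def FM by blast
  moreover have "(f (g x), f (g y)) \<in> U" if "(x, y) \<in> L" for x y
    using f that unfolding order_embedding_def M_def by force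
  ultimately have "order_embedding L U (f \<circ> g)"
    using f unfolding order_embedding_def FM by (auto simp: image_comp)
  then show ?thesis by blast
qed

end

theory Submission
  imports Defs "HOL-Library.Fun_Lexorder" "HOL-Analysis.Abstract_Topology_2"
begin

text \<open>
  The proof follows the method of Kojman and Shelah: a linear order of size \<open>\<kappa>\<close> can realize only
  \<open>\<kappa>\<close> many values of a certain invariant, embeddings preserve it at suitable points, and a linear order of
  size \<open>\<kappa>\<close> can be built to realize any prescribed one of the continuum many values.

  Write the given order \<open>U\<close> as an increasing union of its parts of rank below \<open>a\<close>, for \<open>a < \<kappa>\<close>.  For a
  point \<open>u\<close> and an increasing sequence \<open>c\<close> of ordinals below \<open>\<kappa>\<close>, the invariant is the set of stages \<open>n\<close>
  at which the cut of \<open>u\<close> over one part along \<open>c\<close> is already realized in the next one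
  (\<open>invariant\<close>).  It depends on the ranking, but only up to a club: if all \<open>c n\<close> lie in a suitable
  club, determined by the embedding, an embedding carries the points considered below
  to points with the same invariant.  This is where club guessing enters
  (\<open>omega_club_guessing\<close>): because \<open>\<omega>\<^sub>1 < \<kappa>\<close>, there is a family of only \<open>\<kappa>\<close> many sequences such
  that every club contains one of them.  Points and guesses together give at most \<open>\<kappa>\<close> invariants, so
  some set \<open>A\<close> of natural numbers is not an invariant of \<open>U\<close> along any guess.

  The order that does not embed consists of sequences of reals, compared lexicographically.
  Since \<open>\<kappa>\<close> is below the continuum, ordinals below \<open>\<kappa>\<close> can be named by distinct reals \<open>g b\<close>.  The
  point \<open>coded_point g c A\<close> has as its coordinate \<open>n\<close> the name of an ordinal that appears either just
  in time to realize the cut at stage \<open>n\<close>, or too late, according to whether \<open>n \<in> A\<close>.  Finite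
  sequences ending in a rational, padded with zeros, are added; density of the rationals makes them separate any two
  sequences whose first difference comes early.  If this order embeds into \<open>U\<close>, a guess within the
  club of \<open>elementary_club\<close> gives, by \<open>invariant_coded_point\<close>, a point of \<open>U\<close> with invariant \<open>A\<close>, a
  contradiction.
\<close>

section \<open>Small sets and closure points below a regular cardinal\<close>

lemma regularCard_bounded:
  assumes r: "Card_order r" "regularCard r" and inf: "infinite (Field r)"
    and X: "X \<subseteq> Field r" "|X| <o r"
  shows "\<exists>b\<in>Field r. \<forall>x\<in>X. (x, b) \<in> r \<and> x \<noteq> b"
proof -
  have "\<not> cofinal X r"
    using r(2) X not_ordLess_ordIso unfolding regularCard_def by blast
  then obtain a where a: "a \<in> Field r" "\<And>x. x \<in> X \<Longrightarrow> a = x \<or> (a, x) \<notin> r"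
    unfolding cofinal_def by blast
  obtain b where b: "b \<in> Field r" "a \<noteq> b" "(a, b) \<in> r"
    using infinite_Card_order_limit[OF r(1) inf a(1)] by blast
  have wo: "Well_order r"
    using r(1) card_order_on_well_order_on by blast
  interpret wo_rel r using wo by (simp add: wo_rel_def)
  show ?thesis
  proof (intro bexI ballI)
    fix x assume x: "x \<in> X"
    have "(x, a) \<in> r"
      using a x X(1) TOTALS REFL unfolding refl_on_def by blast
    then show "(x, b) \<in> r \<and> x \<noteq> b"
      using b TRANS ANTISYM unfolding trans_def antisym_def by blast
  qed (rule b)
qed

locale regular_uncountable =
  fixes \<kappa> :: "'k rel"
  assumes card: "Card_order \<kappa>" and reg: "regularCard \<kappa>" and unc: "natLeq <o \<kappa>"
begin

abbreviation K :: "'k set" where "K \<equiv> Field \<kappa>"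

abbreviation le :: "'k \<Rightarrow> 'k \<Rightarrow> bool" (infix \<open>\<sqsubseteq>\<close> 50) where
  "a \<sqsubseteq> b \<equiv> (a, b) \<in> \<kappa>"

abbreviation lt :: "'k \<Rightarrow> 'k \<Rightarrow> bool" (infix \<open>\<sqsubset>\<close> 50) where
  "a \<sqsubset> b \<equiv> (a, b) \<in> \<kappa> \<and> a \<noteq> b"

abbreviation small :: "'b set \<Rightarrow> bool" where
  "small X \<equiv> |X| <o \<kappa>"

lemma well: "Well_order \<kappa>"
  using card card_order_on_well_order_on by blast

lemma infinite_K: "infinite K"
proof
  assume "finite K"
  then have "|K| <o \<kappa>"
    using unc finite_iff_ordLess_natLeq ordLess_transitive by blast
  then show False using card_of_Field_ordIso[OF card] not_ordLess_ordIso by blast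
qed

lemma le_refl: "a \<in> K \<Longrightarrow> a \<sqsubseteq> a"
  using well by (auto simp: order_on_defs refl_on_def)

lemma le_trans: "a \<sqsubseteq> b \<Longrightarrow> b \<sqsubseteq> c \<Longrightarrow> a \<sqsubseteq> c"
  using well by (auto simp: order_on_defs dest: transD)

lemma le_antisym: "a \<sqsubseteq> b \<Longrightarrow> b \<sqsubseteq> a \<Longrightarrow> a = b"
  using well by (auto simp: order_on_defs dest: antisymD)

lemma lt_le_trans: "a \<sqsubset> b \<Longrightarrow> b \<sqsubseteq> c \<Longrightarrow> a \<sqsubset> c"
  using le_trans le_antisym by metis

lemma le_lt_trans: "a \<sqsubseteq> b \<Longrightarrow> b \<sqsubset> c \<Longrightarrow> a \<sqsubset> c"
  using le_trans le_antisym by metis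

lemma le_K: "a \<sqsubseteq> b \<Longrightarrow> a \<in> K" "a \<sqsubseteq> b \<Longrightarrow> b \<in> K"
  by (auto simp: Field_def)

lemma le_linear: "a \<in> K \<Longrightarrow> b \<in> K \<Longrightarrow> a \<sqsubseteq> b \<or> b \<sqsubset> a"
  using well unfolding order_on_defs total_on_def refl_on_def by metis

lemma least_exists:
  assumes "X \<subseteq> K" "X \<noteq> {}"
  shows "\<exists>m\<in>X. \<forall>x\<in>X. m \<sqsubseteq> x"
proof -
  interpret wo_rel \<kappa> using well by (simp add: wo_rel_def)
  show ?thesis using minim_least[OF assms(1)] minim_in[OF assms] by blast
qed

lemma small_mono: "small Y \<Longrightarrow> X \<subseteq> Y \<Longrightarrow> small X"
  using card_of_mono1 ordLeq_ordLess_trans by blast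

lemma small_image: "small X \<Longrightarrow> small (f ` X)"
  using card_of_image ordLeq_ordLess_trans by blast

lemma stable: "stable \<kappa>"
  using regularCard_stable[OF card infinite_K reg] .

lemma small_UN: "small I \<Longrightarrow> (\<And>i. i \<in> I \<Longrightarrow> small (A i)) \<Longrightarrow> small (\<Union>i\<in>I. A i)"
  using stable_UNION[OF stable] by blast

lemma small_Times: "small A \<Longrightarrow> small B \<Longrightarrow> small (A \<times> B)"
  using stable_elim[OF stable, of A "\<lambda>_. B"] by simp

lemma small_Un: "small A \<Longrightarrow> small B \<Longrightarrow> small (A \<union> B)"
  using card_of_Un_ordLess_infinite_Field[OF infinite_K card] by blast

lemma small_countable:
  assumes "countable A" shows "small A"
proof -
  have "|A| \<le>o |UNIV :: nat set|"
    using assms card_of_ordLeq[of A "UNIV :: nat set"] unfolding countable_def by auto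
  then show ?thesis
    using unc card_of_nat ordLeq_ordIso_trans ordLeq_ordLess_trans by blast
qed

lemma small_below:
  assumes "a \<in> K" shows "small {b. b \<sqsubseteq> a}"
proof -
  have "{b. b \<sqsubseteq> a} = underS \<kappa> a \<union> {a}"
    using assms le_refl by (auto simp: underS_def)
  then show ?thesis
    using small_Un[OF card_of_underS[OF card assms] small_countable[of "{a}"]] by simp
qed

lemma bounded: "X \<subseteq> K \<Longrightarrow> small X \<Longrightarrow> \<exists>b\<in>K. \<forall>x\<in>X. x \<sqsubset> b"
  using regularCard_bounded[OF card reg infinite_K] .

text \<open>
  The value is meaningful only for small subsets of \<open>K\<close>, which regularity makes bounded.
\<close>

definition above :: "'k set \<Rightarrow> 'k" where
  "above X = (SOME b. b \<in> K \<and> (\<forall>x\<in>X. x \<sqsubset> b))"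

lemma above:
  assumes "X \<subseteq> K" "small X"
  shows "above X \<in> K" "\<And>x. x \<in> X \<Longrightarrow> x \<sqsubset> above X"
proof -
  have "above X \<in> K \<and> (\<forall>x\<in>X. x \<sqsubset> above X)"
    unfolding above_def by (rule someI_ex) (use bounded[OF assms] in blast)
  then show "above X \<in> K" "\<And>x. x \<in> X \<Longrightarrow> x \<sqsubset> above X" by blast+
qed

lemma strict_supremum:
  assumes "X \<subseteq> K" "small X"
  shows "\<exists>d\<in>K. (\<forall>x\<in>X. x \<sqsubset> d) \<and> (\<forall>b. b \<sqsubset> d \<longrightarrow> (\<exists>x\<in>X. b \<sqsubseteq> x))"
proof -
  let ?B = "{b \<in> K. \<forall>x\<in>X. x \<sqsubset> b}"
  have "?B \<noteq> {}" using bounded[OF assms] by blast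
  then obtain d where d: "d \<in> ?B" "\<forall>b\<in>?B. d \<sqsubseteq> b" using least_exists[of ?B] by blast
  have "\<exists>x\<in>X. b \<sqsubseteq> x" if b: "b \<sqsubset> d" for b
  proof -
    have bK: "b \<in> K" using b le_K by blast
    have "b \<notin> ?B" using d(2) b le_antisym by blast
    then obtain x where "x \<in> X" "\<not> x \<sqsubset> b" using bK by blast
    then show ?thesis using le_linear[OF bK, of x] assms(1) by blast
  qed
  then show ?thesis using d(1) by blast
qed

text \<open>
  These sets stand in for the closed unbounded subsets of \<open>\<kappa>\<close>: every one of those contains the
  closure points of some \<open>F\<close>, up to the least element of \<open>\<kappa>\<close>, and the intersection of fewer than
  \<open>\<kappa>\<close> sets \<open>closure_points F\<close> contains the closure points of a pointwise upper bound of the \<open>F\<close>.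
  That least element is a closure point vacuously; this makes \<open>drop_to\<close> below a total operation.
\<close>

definition closure_points :: "('k \<Rightarrow> 'k) \<Rightarrow> 'k set" where
  "closure_points F = {a \<in> K. \<forall>b. b \<sqsubset> a \<longrightarrow> F b \<sqsubset> a}"

text \<open>
  Topological closedness, phrased so that the cases \<open>s \<in> closure_points F\<close>, \<open>s\<close> a limit of closure
  points, and \<open>s\<close> least in \<open>K\<close> need no distinction.
\<close>

lemma closure_points_closed:
  assumes "s \<in> K" "\<And>b. b \<sqsubset> s \<Longrightarrow> \<exists>c\<in>closure_points F. b \<sqsubset> c \<and> c \<sqsubseteq> s"
  shows "s \<in> closure_points F"
  unfolding closure_points_def
proof (intro CollectI conjI allI impI)
  fix b assume "b \<sqsubset> s"
  then obtain c where "c \<in> closure_points F" "b \<sqsubset> c" "c \<sqsubseteq> s" using assms(2) by blast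
  then show "F b \<sqsubseteq> s" "F b \<noteq> s"
    using lt_le_trans[of "F b" c s] unfolding closure_points_def by blast+
qed (rule assms(1))

lemma closure_points_antimono:
  assumes "\<And>b. b \<in> K \<Longrightarrow> F b \<sqsubseteq> F' b"
  shows "closure_points F' \<subseteq> closure_points F"
proof
  fix a assume a: "a \<in> closure_points F'"
  have "F b \<sqsubset> a" if "b \<sqsubset> a" for b
    using that a assms[OF le_K(1)[of b a]] le_lt_trans[of "F b" "F' b" a]
    unfolding closure_points_def by blast
  then show "a \<in> closure_points F" using a unfolding closure_points_def by blast
qed

text \<open>
  Iterate \<open>\<omega>\<close> times the step from \<open>a\<close> to a bound of \<open>F\<close> on everything up to \<open>a\<close>; the supremum of the
  iterates exists since \<open>\<kappa>\<close> has uncountable cofinality, and it is closed under \<open>F\<close>.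
\<close>

lemma closure_points_unbounded:
  assumes F: "\<And>b. b \<in> K \<Longrightarrow> F b \<in> K" and "b \<in> K"
  shows "\<exists>c\<in>closure_points F. b \<sqsubset> c"
proof -
  define step where "step a = above ({a} \<union> F ` {x. x \<sqsubseteq> a})" for a
  have step: "step a \<in> K" "a \<sqsubset> step a" "\<And>x. x \<sqsubseteq> a \<Longrightarrow> F x \<sqsubset> step a" if "a \<in> K" for a
  proof -
    have 1: "{a} \<union> F ` {x. x \<sqsubseteq> a} \<subseteq> K" using that F le_K by blast
    have 2: "small ({a} \<union> F ` {x. x \<sqsubseteq> a})"
      by (intro small_Un small_image small_below that small_countable) simp
    show "step a \<in> K" "a \<sqsubset> step a" "\<And>x. x \<sqsubseteq> a \<Longrightarrow> F x \<sqsubset> step a"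
      unfolding step_def using above[OF 1 2] by blast+
  qed
  define it where "it n = (step ^^ n) b" for n
  have itK: "it n \<in> K" for n
    by (induction n) (use step \<open>b \<in> K\<close> in \<open>auto simp: it_def\<close>)
  have it_Suc: "it (Suc n) = step (it n)" for n by (simp add: it_def)
  have "\<exists>c\<in>K. (\<forall>x\<in>range it. x \<sqsubset> c) \<and> (\<forall>x. x \<sqsubset> c \<longrightarrow> (\<exists>y\<in>range it. x \<sqsubseteq> y))"
    by (rule strict_supremum) (use itK in \<open>auto intro: small_countable\<close>)
  then obtain c where c: "c \<in> K" "\<And>n. it n \<sqsubset> c" "\<And>x. x \<sqsubset> c \<Longrightarrow> \<exists>n. x \<sqsubseteq> it n"
    by auto
  have "F x \<sqsubset> c" if x: "x \<sqsubset> c" for x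
  proof -
    obtain n where "x \<sqsubseteq> it n" using c(3) x by blast
    then have "F x \<sqsubset> it (Suc n)" using step(3) itK it_Suc by metis
    then show ?thesis using lt_le_trans[of "F x" "it (Suc n)" c] c(2) by blast
  qed
  moreover have "b \<sqsubset> c" using c(2)[of 0] by (simp add: it_def)
  ultimately show ?thesis using c(1) unfolding closure_points_def by blast
qed

lemma increasing_sequence:
  assumes "X \<subseteq> K" "X \<noteq> {}" "\<And>x. x \<in> X \<Longrightarrow> \<exists>y\<in>X. x \<sqsubset> y"
  shows "\<exists>e. range e \<subseteq> X \<and> (\<forall>n::nat. e n \<sqsubset> e (Suc n))"
proof -
  obtain h where h: "\<And>x. x \<in> X \<Longrightarrow> h x \<in> X \<and> x \<sqsubset> h x"
    using assms(3) by metis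
  obtain x where "x \<in> X" using assms(2) by blast
  define e where "e n = (h ^^ n) x" for n
  have "e n \<in> X" for n
    by (induction n) (use h \<open>x \<in> X\<close> in \<open>auto simp: e_def\<close>)
  then show ?thesis using h by (intro exI[of _ e]) (auto simp: e_def)
qed

lemma increasing_less:
  assumes "\<And>n::nat. e n \<sqsubset> e (Suc n)" "m < n"
  shows "e m \<sqsubset> e n"
  using assms(2)
proof (induction n)
  case (Suc n)
  then show ?case
    using assms(1)[of n] lt_le_trans[of "e m" "e n" "e (Suc n)"] by (cases "m = n") auto
qed simp

section \<open>Guessing clubs by \<omega>-sequences\<close>

text \<open>
  The maximum asked for exists, since the supremum of a set of closure points is a closure point.
\<close>

definition drop_to :: "('k \<Rightarrow> 'k) \<Rightarrow> 'k \<Rightarrow> 'k" where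
  "drop_to F b = (SOME d. d \<in> closure_points F \<and> d \<sqsubseteq> b \<and> (\<forall>c\<in>closure_points F. c \<sqsubseteq> b \<longrightarrow> c \<sqsubseteq> d))"

lemma drop_to:
  assumes "b \<in> K"
  shows "drop_to F b \<in> closure_points F" "drop_to F b \<sqsubseteq> b"
    "\<And>c. c \<in> closure_points F \<Longrightarrow> c \<sqsubseteq> b \<Longrightarrow> c \<sqsubseteq> drop_to F b"
proof -
  define X where "X = {c \<in> closure_points F. c \<sqsubseteq> b}"
  have "b \<in> {s \<in> K. \<forall>c\<in>X. c \<sqsubseteq> s}" using assms unfolding X_def by blast
  then obtain s where s: "s \<in> K" "\<And>c. c \<in> X \<Longrightarrow> c \<sqsubseteq> s"
      "\<And>t. t \<in> K \<Longrightarrow> (\<And>c. c \<in> X \<Longrightarrow> c \<sqsubseteq> t) \<Longrightarrow> s \<sqsubseteq> t"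
    using least_exists[of "{s \<in> K. \<forall>c\<in>X. c \<sqsubseteq> s}"] by blast
  have "s \<sqsubseteq> b" using s(3)[OF assms] unfolding X_def by blast
  moreover have "s \<in> closure_points F"
  proof (rule closure_points_closed[OF s(1)])
    fix t assume t: "t \<sqsubset> s"
    then have tK: "t \<in> K" using le_K by blast
    then obtain c where "c \<in> X" "\<not> c \<sqsubseteq> t" using s(3)[OF tK] t le_antisym by blast
    then show "\<exists>c\<in>closure_points F. t \<sqsubset> c \<and> c \<sqsubseteq> s"
      using le_linear[of c t] tK s(2) le_K unfolding X_def by blast
  qed
  ultimately have ex: "\<exists>d. d \<in> closure_points F \<and> d \<sqsubseteq> b \<and> (\<forall>c\<in>closure_points F. c \<sqsubseteq> b \<longrightarrow> c \<sqsubseteq> d)"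
    using s(2) unfolding X_def by blast
  show "drop_to F b \<in> closure_points F" "drop_to F b \<sqsubseteq> b"
    "\<And>c. c \<in> closure_points F \<Longrightarrow> c \<sqsubseteq> b \<Longrightarrow> c \<sqsubseteq> drop_to F b"
    using someI_ex[OF ex] unfolding drop_to_def by blast+
qed


lemma drop_to_antimono:
  assumes "b \<in> K" "closure_points F' \<subseteq> closure_points F"
  shows "drop_to F' b \<sqsubseteq> drop_to F b"
  using drop_to[OF assms(1)] assms(2) by blast

text \<open>
  Shelah's club guessing at points of cofinality \<open>\<omega>\<close>.  Fix for every such point \<open>d\<close> a cofinal
  sequence \<open>ladder d\<close>.  Given a club, push each ladder down into it with \<open>drop_to\<close>.  If none of the
  resulting families guesses, then for each club there is one that its family misses; iterating this
  \<open>\<omega>\<^sub>1\<close> times produces a decreasing sequence of clubs, whose intersection is still a club because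
  \<open>\<omega>\<^sub>1 < \<kappa>\<close>.  At a limit \<open>d\<close> of the intersection, each of the countably many points
  \<open>drop_to (H i) (ladder d n)\<close> decreases with \<open>i\<close>, hence is eventually constant, and as \<open>\<omega>\<^sub>1\<close> is
  regular they are all constant from one stage \<open>i\<close> on.  So the ladder dropped at stage \<open>i\<close> already lies
  in the later clubs, although the club chosen after stage \<open>i\<close> was to miss it.
\<close>

lemma omega_club_guessing:
  assumes omega1: "cardSuc natLeq <o \<kappa>"
  shows "\<exists>c. \<forall>F. (\<forall>b\<in>K. F b \<in> K) \<longrightarrow>
    (\<exists>d\<in>K. range (c d) \<subseteq> closure_points F \<and> (\<forall>n::nat. c d n \<sqsubset> c d (Suc n)))"
proof (rule ccontr)
  assume no_guess: "\<not> ?thesis"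
  define maps where "maps F \<longleftrightarrow> (\<forall>b\<in>K. F b \<in> K)" for F
  \<comment> \<open>A dropped ladder may repeat values, so a strictly increasing sequence is extracted from its range.\<close>
  define seq where "seq X = (SOME s. range s \<subseteq> X \<and> (\<forall>n::nat. s n \<sqsubset> s (Suc n)))" for X
  have seq: "range (seq X) \<subseteq> X \<and> (\<forall>n. seq X n \<sqsubset> seq X (Suc n))"
    if "\<exists>s. range s \<subseteq> X \<and> (\<forall>n::nat. s n \<sqsubset> s (Suc n))" for X
    unfolding seq_def using that by (rule someI_ex)
  define ladder where "ladder d = (SOME s. \<forall>n::nat. s n \<sqsubset> d \<and> (\<forall>b. b \<sqsubset> d \<longrightarrow> (\<exists>n. b \<sqsubset> s n)))" for d
  define dropped where "dropped F d = range (\<lambda>n. drop_to F (ladder d n))" for F d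
  have "\<exists>F'. maps F' \<and> (\<forall>d\<in>K. range (seq (dropped F d)) \<subseteq> closure_points F' \<longrightarrow>
      \<not> (\<forall>n. seq (dropped F d) n \<sqsubset> seq (dropped F d) (Suc n)))" for F
  proof -
    have "\<not> (\<forall>F'. (\<forall>b\<in>K. F' b \<in> K) \<longrightarrow> (\<exists>d\<in>K. range (seq (dropped F d)) \<subseteq> closure_points F' \<and>
        (\<forall>n. seq (dropped F d) n \<sqsubset> seq (dropped F d) (Suc n))))"
      using no_guess by (rule contrapos_nn) (rule exI[of _ "\<lambda>d. seq (dropped F d)"])
    then show ?thesis unfolding maps_def by meson
  qed
  then obtain miss where miss: "\<And>F. maps (miss F)"
      "\<And>F d. d \<in> K \<Longrightarrow> range (seq (dropped F d)) \<subseteq> closure_points (miss F) \<Longrightarrow>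
        \<not> (\<forall>n. seq (dropped F d) n \<sqsubset> seq (dropped F d) (Suc n))"
    by metis

  define W where "W = cardSuc natLeq"
  have W: "Card_order W" "regularCard W" "infinite (Field W)" "natLeq <o W"
    unfolding W_def using natLeq_Card_order natLeq_Cinfinite
    by (auto intro: cardSuc_Card_order regularCard_cardSuc cardSuc_greater simp: cardSuc_finite Field_natLeq)
  have woW: "Well_order W" using W(1) card_order_on_well_order_on by blast
  then have wfW: "wf (W - Id)" and transW: "trans W" and antisymW: "antisym W"
    by (auto simp: order_on_defs)
  have smallW: "small I" if "I \<subseteq> Field W" for I
  proof -
    have "|Field W| =o W" using card_of_Field_ordIso[OF W(1)] .
    then have "small (Field W)" using omega1 ordIso_ordLess_trans unfolding W_def by blast
    then show ?thesis using small_mono that by blast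
  qed

  \<comment> \<open>Taking pointwise bounds of all earlier \<open>H j\<close> and \<open>miss (H j)\<close> makes the clubs decrease.\<close>
  define H where "H = wfrec (W - Id) (\<lambda>h i b. above ((\<lambda>j. miss (h j) b) ` underS W i \<union> (\<lambda>j. h j b) ` underS W i))"
  have H: "H i b = above ((\<lambda>j. miss (H j) b) ` underS W i \<union> (\<lambda>j. H j b) ` underS W i)" for i b
  proof -
    have "cut H (W - Id) i j = H j" if "j \<in> underS W i" for j
      using that by (auto simp: cut_def underS_def)
    then show ?thesis
      unfolding H_def by (subst wfrec[OF wfW]) (fold H_def, simp cong: image_cong)
  qed
  have under_Field: "underS W i \<subseteq> Field W" for i
    by (auto simp: underS_def Field_def)
  have H_step: "H i b \<in> K \<and> (\<forall>j\<in>underS W i. miss (H j) b \<sqsubset> H i b \<and> H j b \<sqsubset> H i b)"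
    if "b \<in> K" for i b
    using wfW
  proof (induction i)
    case (less i)
    let ?X = "(\<lambda>j. miss (H j) b) ` underS W i \<union> (\<lambda>j. H j b) ` underS W i"
    have "H j b \<in> K" if "j \<in> underS W i" for j
      using less that by (auto simp: underS_def)
    then have 1: "?X \<subseteq> K" using miss(1) \<open>b \<in> K\<close> unfolding maps_def by blast
    have 2: "small ?X" by (intro small_Un small_image smallW under_Field)
    show ?case using above[OF 1 2] unfolding H[symmetric] by blast
  qed
  have H_maps: "maps (H i)" for i using H_step unfolding maps_def by blast
  have H_less: "closure_points (H i) \<subseteq> closure_points (H j)"
      "closure_points (H i) \<subseteq> closure_points (miss (H j))" if "j \<in> underS W i" for i j
    by (rule closure_points_antimono, use H_step that in blast)+

  define F where "F b = above ((\<lambda>i. H i b) ` Field W)" for b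
  have F: "F b \<in> K" "\<And>i. i \<in> Field W \<Longrightarrow> H i b \<sqsubset> F b" if "b \<in> K" for b
  proof -
    have 1: "(\<lambda>i. H i b) ` Field W \<subseteq> K" using H_maps that unfolding maps_def by blast
    have 2: "small ((\<lambda>i. H i b) ` Field W)" by (intro small_image smallW order_refl)
    show "F b \<in> K" "\<And>i. i \<in> Field W \<Longrightarrow> H i b \<sqsubset> F b"
      unfolding F_def using above[OF 1 2] by blast+
  qed
  have F_H: "closure_points F \<subseteq> closure_points (H i)" if "i \<in> Field W" for i
    by (rule closure_points_antimono) (use F that in blast)
  have "closure_points F \<noteq> {}"
  proof -
    obtain b where "b \<in> K" using infinite_K by fastforce
    then show ?thesis using closure_points_unbounded[of F b] F(1) by blast
  qed
  moreover have "\<exists>y\<in>closure_points F. x \<sqsubset> y" if "x \<in> closure_points F" for x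
    using closure_points_unbounded[of F x] F(1) that unfolding closure_points_def by blast
  moreover have "closure_points F \<subseteq> K" unfolding closure_points_def by blast
  ultimately obtain e where e: "range e \<subseteq> closure_points F" "\<And>n::nat. e n \<sqsubset> e (Suc n)"
    using increasing_sequence[of "closure_points F"] by metis
  have eK: "range e \<subseteq> K" using e(1) unfolding closure_points_def by blast
  have "\<exists>d\<in>K. (\<forall>x\<in>range e. x \<sqsubset> d) \<and> (\<forall>b. b \<sqsubset> d \<longrightarrow> (\<exists>x\<in>range e. b \<sqsubseteq> x))"
    by (rule strict_supremum[OF eK]) (simp add: small_countable)
  then obtain d where d: "d \<in> K" "\<And>n. e n \<sqsubset> d" "\<And>b. b \<sqsubset> d \<Longrightarrow> \<exists>n. b \<sqsubseteq> e n"
    by auto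
  have e_cofinal: "\<exists>n. b \<sqsubset> e n" if b: "b \<sqsubset> d" for b
  proof -
    obtain n where "b \<sqsubseteq> e n" using d(3)[OF b] ..
    then have "b \<sqsubset> e (Suc n)" using e(2)[of n] by (rule le_lt_trans)
    then show ?thesis ..
  qed
  have "\<exists>s. \<forall>n::nat. s n \<sqsubset> d \<and> (\<forall>b. b \<sqsubset> d \<longrightarrow> (\<exists>n. b \<sqsubset> s n))"
    by (intro exI[of _ e] allI conjI[OF d(2)] impI e_cofinal)
  then have "\<forall>n::nat. ladder d n \<sqsubset> d \<and> (\<forall>b. b \<sqsubset> d \<longrightarrow> (\<exists>n. b \<sqsubset> ladder d n))"
    unfolding ladder_def by (rule someI_ex)
  then have ladder: "\<And>n. ladder d n \<sqsubset> d" "\<And>b. b \<sqsubset> d \<Longrightarrow> \<exists>n. b \<sqsubset> ladder d n"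
    by blast+
  have ladderK: "ladder d n \<in> K" for n using le_K(1)[OF conjunct1[OF ladder(1)]] .

  \<comment> \<open>A decreasing sequence of ordinals is constant from the stage where it is minimal.\<close>
  have "\<exists>i\<in>Field W. \<forall>j\<in>Field W. drop_to (H i) (ladder d n) \<sqsubseteq> drop_to (H j) (ladder d n)" for n
  proof -
    let ?X = "(\<lambda>i. drop_to (H i) (ladder d n)) ` Field W"
    have "?X \<subseteq> K" using drop_to(2)[OF ladderK] le_K by blast
    moreover have "?X \<noteq> {}" using W(3) by auto
    ultimately show ?thesis using least_exists[of ?X] by blast
  qed
  then obtain stage where stage: "\<And>n. stage n \<in> Field W"
      "\<And>n j. j \<in> Field W \<Longrightarrow> drop_to (H (stage n)) (ladder d n) \<sqsubseteq> drop_to (H j) (ladder d n)"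
    by metis
  have "|range stage| \<le>o natLeq"
    by (rule ordLeq_ordIso_trans[OF card_of_image card_of_nat])
  then have "|range stage| <o W" using W(4) ordLeq_ordLess_trans by blast
  then obtain i where i: "i \<in> Field W" "\<And>n. (stage n, i) \<in> W \<and> stage n \<noteq> i"
    using regularCard_bounded[OF W(1-3), of "range stage"] stage(1)
    by (simp add: image_subset_iff) metis
  obtain j where j: "j \<in> Field W" "(i, j) \<in> W" "i \<noteq> j"
    using infinite_Card_order_limit[OF W(1) W(3) i(1)] by blast
  have stable_drop: "drop_to (H i) (ladder d n) = drop_to (H j) (ladder d n)" for n
  proof -
    have sub: "stage n \<in> underS W i" "i \<in> underS W j" using i j by (auto simp: underS_def)
    have "drop_to (H j) (ladder d n) \<sqsubseteq> drop_to (H i) (ladder d n)"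
      by (rule drop_to_antimono[OF ladderK H_less(1)[OF sub(2)]])
    moreover have "drop_to (H i) (ladder d n) \<sqsubseteq> drop_to (H (stage n)) (ladder d n)"
      by (rule drop_to_antimono[OF ladderK H_less(1)[OF sub(1)]])
    ultimately show ?thesis using stage(2)[OF j(1)] le_trans le_antisym by metis
  qed
  have in_miss: "dropped (H i) d \<subseteq> closure_points (miss (H i))"
  proof -
    have "drop_to (H i) (ladder d n) \<in> closure_points (H j)" for n
      unfolding stable_drop using drop_to(1)[OF ladderK] .
    then show ?thesis
      unfolding dropped_def using H_less(2)[of i j] j by (auto simp: underS_def)
  qed
  have increasing: "range (seq (dropped (H i) d)) \<subseteq> dropped (H i) d \<and>
      (\<forall>n. seq (dropped (H i) d) n \<sqsubset> seq (dropped (H i) d) (Suc n))"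
  proof (rule seq, rule increasing_sequence)
    show "dropped (H i) d \<subseteq> K"
      unfolding dropped_def using drop_to(2)[OF ladderK] le_K by blast
    show "dropped (H i) d \<noteq> {}" unfolding dropped_def by blast
    fix x assume "x \<in> dropped (H i) d"
    then obtain n where x: "x = drop_to (H i) (ladder d n)" unfolding dropped_def by blast
    obtain m where m: "ladder d n \<sqsubset> e m" using e_cofinal[OF ladder(1)] by blast
    obtain n' where n': "e m \<sqsubset> ladder d n'" using ladder(2)[OF d(2)] by blast
    have "e m \<sqsubseteq> drop_to (H i) (ladder d n')"
      using drop_to(3)[OF ladderK] e(1) F_H[OF i(1)] n' by blast
    moreover have "x \<sqsubset> e m" using drop_to(2)[OF ladderK] m le_lt_trans unfolding x by blast
    ultimately show "\<exists>y\<in>dropped (H i) d. x \<sqsubset> y"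
      using lt_le_trans unfolding dropped_def by blast
  qed
  show False
    using miss(2)[OF d(1) subset_trans[OF conjunct1[OF increasing] in_miss]]
      conjunct2[OF increasing] ..
qed

end

section \<open>Lexicographically ordered sequences\<close>

definition lex_on :: "(nat \<Rightarrow> 'a::linorder) set \<Rightarrow> (nat \<Rightarrow> 'a) rel" where
  "lex_on X = {(s, t). s \<in> X \<and> t \<in> X \<and> (s = t \<or> less_fun s t)}"

lemma Field_lex_on: "Field (lex_on X) = X"
  by (auto simp: lex_on_def Field_def)

lemma first_difference:
  fixes s t :: "nat \<Rightarrow> 'a"
  assumes "s \<noteq> t"
  shows "\<exists>j. (\<forall>i<j. s i = t i) \<and> s j \<noteq> t j"
proof -
  have "\<exists>j. s j \<noteq> t j" using assms by blast
  then show ?thesis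
    using not_less_Least[of _ "\<lambda>j. s j \<noteq> t j"] LeastI_ex[of "\<lambda>j. s j \<noteq> t j"]
    by blast
qed

lemma less_fun_between:
  fixes r s t :: "nat \<Rightarrow> 'a::linorder"
  assumes "less_fun r s" "less_fun s t" "\<And>i. i \<le> n \<Longrightarrow> r i = t i" "i \<le> n"
  shows "s i = r i"
proof -
  obtain k where k: "r k < s k" "\<And>i. i < k \<Longrightarrow> r i = s i"
    using less_funE[OF assms(1)] by blast
  obtain l where l: "s l < t l" "\<And>i. i < l \<Longrightarrow> s i = t i"
    using less_funE[OF assms(2)] by blast
  have "n < k"
  proof (rule ccontr)
    assume "\<not> n < k"
    then have rk: "r k = t k" using assms(3) by simp
    show False
    proof (cases l k rule: linorder_cases)
      case less
      then have "r l = t l" using assms(3) \<open>\<not> n < k\<close> by simp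
      then show ?thesis using k(2)[OF less] l(1) by simp
    next
      case equal
      then show ?thesis using k(1) l(1) rk by auto
    next
      case greater
      then show ?thesis using l(2)[OF greater] k(1) rk by simp
    qed
  qed
  then show ?thesis using k(2)[of i] assms(4) by simp
qed

lemma Linear_order_lex_on: "Linear_order (lex_on X)"
proof -
  have "less_fun s t \<or> less_fun t s" if "s \<noteq> t" for s t :: "nat \<Rightarrow> 'a"
  proof -
    obtain j where "\<forall>i<j. s i = t i" "s j \<noteq> t j"
      using first_difference[OF \<open>s \<noteq> t\<close>] by blast
    then show ?thesis unfolding less_fun_def by (metis linorder_neqE)
  qed
  then have "total_on X (lex_on X)"
    unfolding total_on_def lex_on_def by blast
  moreover have "trans (lex_on X)"
    unfolding lex_on_def by (rule transI) (auto intro: less_fun_trans)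
  moreover have "antisym (lex_on X)"
    unfolding lex_on_def by (rule antisymI) (auto dest: less_fun_asym)
  moreover have "refl_on X (lex_on X)" "lex_on X \<subseteq> X \<times> X"
    unfolding lex_on_def refl_on_def by auto
  ultimately show ?thesis unfolding order_on_defs Field_lex_on by blast
qed

context regular_uncountable
begin

section \<open>Invariants of points of a ranked linear order\<close>

lemma closed_under_small:
  assumes "\<And>b. b \<in> K \<Longrightarrow> small (R b)"
  shows "\<exists>F. (\<forall>b\<in>K. F b \<in> K) \<and> (\<forall>a\<in>closure_points F. \<forall>b. b \<sqsubset> a \<longrightarrow> (\<forall>x\<in>R b \<inter> K. x \<sqsubset> a))"
proof (intro exI conjI ballI allI impI)
  let ?F = "\<lambda>b. above (R b \<inter> K)"
  have small: "small (R b \<inter> K)" if "b \<in> K" for b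
    using assms[OF that] small_mono by blast
  show "?F b \<in> K" if "b \<in> K" for b
    using above(1) small[OF that] by blast
  fix a b x
  assume a: "a \<in> closure_points ?F" and b: "b \<sqsubset> a" and x: "x \<in> R b \<inter> K"
  have bK: "b \<in> K" using b le_K by blast
  have "x \<sqsubset> ?F b" using above(2)[OF _ small[OF bK] x] by blast
  moreover have "?F b \<sqsubset> a" using a b unfolding closure_points_def by blast
  ultimately show "x \<sqsubseteq> a" "x \<noteq> a" using lt_le_trans[of x "?F b" a] by blast+
qed

text \<open>
  Regularity and uncountability of \<open>\<kappa>\<close> suffice: each length contributes a small set by induction, and
  there are only countably many lengths.
\<close>

lemma small_finite_sequences:
  assumes "small B"
  shows "small {s :: nat \<Rightarrow> 'b::zero. \<exists>j. (\<forall>i<j. s i \<in> B) \<and> (\<forall>i\<ge>j. s i = 0)}"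
proof -
  let ?S = "\<lambda>j. {s :: nat \<Rightarrow> 'b. (\<forall>i<j. s i \<in> B) \<and> (\<forall>i\<ge>j. s i = 0)}"
  have S: "small (?S j)" for j
  proof (induction j)
    case 0
    have "?S 0 = {\<lambda>_. 0}" by auto
    then show ?case using small_countable[of "{\<lambda>_. 0} :: (nat \<Rightarrow> 'b) set"] by simp
  next
    case (Suc j)
    have "?S (Suc j) \<subseteq> (\<lambda>(s, b). s(j := b)) ` (?S j \<times> B)"
    proof
      fix s assume s: "s \<in> ?S (Suc j)"
      have "s = (\<lambda>(s, b). s(j := b)) (s(j := 0), s j)" by simp
      moreover have "(s(j := 0), s j) \<in> ?S j \<times> B" using s by (auto simp: less_Suc_eq Suc_le_eq)
      ultimately show "s \<in> (\<lambda>(s, b). s(j := b)) ` (?S j \<times> B)" by (rule image_eqI)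
    qed
    then show ?case
      using small_mono[OF small_image[OF small_Times[OF Suc assms]]] by blast
  qed
  have "small (\<Union>j. ?S j)"
    by (rule small_UN) (auto intro: small_countable S)
  then show ?thesis by (rule small_mono) blast
qed

text \<open>
  The endpoints \<open>u\<close> and \<open>v\<close> themselves count as separating.  Hence points that are not separated by
  the ranks below \<open>a\<close> both have rank at least \<open>a\<close> and realize the same cut over the points of smaller
  rank.
\<close>

definition separated :: "'u rel \<Rightarrow> ('u \<Rightarrow> 'k) \<Rightarrow> 'k \<Rightarrow> 'u \<Rightarrow> 'u \<Rightarrow> bool" where
  "separated U \<rho> a u v \<longleftrightarrow>
     (\<exists>w\<in>Field U. \<rho> w \<sqsubset> a \<and> ((u, w) \<in> U \<and> (w, v) \<in> U \<or> (v, w) \<in> U \<and> (w, u) \<in> U))"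

text \<open>
  The invariant of \<open>u\<close> along an increasing sequence \<open>c\<close> of ranks records at which stages the cut of
  \<open>u\<close> over the points of rank below \<open>c (2 * n + 1)\<close> is realized by a point of rank below
  \<open>c (2 * n + 2)\<close>.  The ranks \<open>c (2 * n)\<close> serve as buffers: they bound the labels that
  \<open>coded_point\<close> uses before coordinate \<open>n\<close>.
\<close>

definition invariant :: "'u rel \<Rightarrow> ('u \<Rightarrow> 'k) \<Rightarrow> (nat \<Rightarrow> 'k) \<Rightarrow> 'u \<Rightarrow> nat set" where
  "invariant U \<rho> c u =
     {n. \<exists>v\<in>Field U. \<rho> v \<sqsubset> c (2 * n + 2) \<and> \<not> separated U \<rho> (c (2 * n + 1)) u v}"

end

text \<open>
  The point whose invariant along \<open>c\<close> will be \<open>A\<close>.  The label of its coordinate \<open>n\<close> becomes available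
  within the stage from \<open>c (2 * n + 1)\<close> to \<open>c (2 * n + 2)\<close> if \<open>n \<in> A\<close>, and only after it otherwise.
\<close>

definition coded_point :: "('k \<Rightarrow> real) \<Rightarrow> (nat \<Rightarrow> 'k) \<Rightarrow> nat set \<Rightarrow> nat \<Rightarrow> real" where
  "coded_point g c A n = (if n \<in> A then g (c (2 * n + 1)) else g (c (2 * n + 2)))"

definition cut_off :: "(nat \<Rightarrow> real) \<Rightarrow> nat \<Rightarrow> real \<Rightarrow> nat \<Rightarrow> real" where
  "cut_off s j q = (\<lambda>n. if n < j then s n else if n = j then q else 0)"

text \<open>
  Points of \<open>L\<close> carry no rank of their own; \<open>s\<close> is ranked by \<open>\<rho> (f s)\<close>.  The embedding \<open>f\<close> then
  respects ranks by definition, and only the coordinates of \<open>s\<close> have to be compared with its rank.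
\<close>

locale ranked_embedding = regular_uncountable \<kappa> for \<kappa> :: "'k rel" +
  fixes U :: "'u rel" and \<rho> :: "'u \<Rightarrow> 'k" and g :: "'k \<Rightarrow> real"
    and L :: "(nat \<Rightarrow> real) set" and f :: "(nat \<Rightarrow> real) \<Rightarrow> 'u"
  assumes U: "Linear_order U"
    and \<rho>: "inj_on \<rho> (Field U)" "\<rho> ` Field U \<subseteq> K"
    and g: "inj_on g K"
    and f: "order_embedding (lex_on L) U f"
begin

lemma U_trans: "(u, v) \<in> U \<Longrightarrow> (v, w) \<in> U \<Longrightarrow> (u, w) \<in> U"
  using U by (auto simp: order_on_defs dest: transD)

lemma U_antisym: "(u, v) \<in> U \<Longrightarrow> (v, u) \<in> U \<Longrightarrow> u = v"
  using U by (auto simp: order_on_defs dest: antisymD)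

lemma U_linear: "u \<in> Field U \<Longrightarrow> v \<in> Field U \<Longrightarrow> (u, v) \<in> U \<or> (v, u) \<in> U"
  using U unfolding order_on_defs total_on_def refl_on_def by metis

lemma f_Field: "s \<in> L \<Longrightarrow> f s \<in> Field U"
  using f unfolding order_embedding_def Field_lex_on by blast

lemma f_inj: "inj_on f L"
  using f unfolding order_embedding_def Field_lex_on by blast

lemma f_less_iff:
  assumes "s \<in> L" "t \<in> L"
  shows "less_fun s t \<longleftrightarrow> (f s, f t) \<in> U \<and> f s \<noteq> f t"
proof -
  have mono: "(f s, f t) \<in> U" if "(s, t) \<in> lex_on L" for s t
    using f that unfolding order_embedding_def by blast
  have "(s, t) \<in> lex_on L \<or> (t, s) \<in> lex_on L \<and> s \<noteq> t"
    using Linear_order_lex_on[of L] assms unfolding order_on_defs Field_lex_on total_on_def refl_on_def by metis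
  then show ?thesis
    using mono U_antisym inj_on_eq_iff[OF f_inj assms] less_fun_irrefl less_fun_asym assms
    unfolding lex_on_def by blast
qed

lemma separated_trans:
  assumes "\<not> separated U \<rho> a u v" "\<not> separated U \<rho> a v w" "u \<in> Field U" "v \<in> Field U" "w \<in> Field U"
  shows "\<not> separated U \<rho> a u w"
  using assms U_linear unfolding separated_def by blast

lemma separated_sym: "separated U \<rho> a u v \<longleftrightarrow> separated U \<rho> a v u"
  unfolding separated_def by blast

text \<open>
  What is needed from the statement that the points of rank below \<open>a\<close> form an elementary substructure
  of \<open>U\<close> with the predicate \<open>f ` L\<close>: witnesses in \<open>L\<close> for being between two points, and for being
  close to a point over a smaller rank, can be found below \<open>a\<close>; finite sequences with labels below
  \<open>a\<close> have rank below \<open>a\<close>; and labels of sequences of rank below \<open>a\<close> are below \<open>a\<close>.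
\<close>

definition elementary :: "'k \<Rightarrow> bool" where
  "elementary a \<longleftrightarrow>
     (\<forall>u\<in>Field U. \<forall>v\<in>Field U. \<forall>s\<in>L. \<rho> u \<sqsubset> a \<longrightarrow> \<rho> v \<sqsubset> a \<longrightarrow>
        (u, f s) \<in> U \<and> u \<noteq> f s \<and> (f s, v) \<in> U \<and> f s \<noteq> v \<longrightarrow>
        (\<exists>t\<in>L. \<rho> (f t) \<sqsubset> a \<and> (u, f t) \<in> U \<and> u \<noteq> f t \<and> (f t, v) \<in> U \<and> f t \<noteq> v)) \<and>
     (\<forall>u\<in>Field U. \<forall>b. \<forall>s\<in>L. \<rho> u \<sqsubset> a \<longrightarrow> b \<sqsubset> a \<longrightarrow> \<not> separated U \<rho> b u (f s) \<longrightarrow>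
        (\<exists>t\<in>L. \<rho> (f t) \<sqsubset> a \<and> \<not> separated U \<rho> b u (f t))) \<and>
     (\<forall>s\<in>L. \<forall>b j. b \<sqsubset> a \<longrightarrow> (\<forall>i<j. s i \<in> g ` {x. x \<sqsubseteq> b}) \<longrightarrow> s j \<in> \<rat> \<longrightarrow> (\<forall>i>j. s i = 0) \<longrightarrow>
        \<rho> (f s) \<sqsubset> a) \<and>
     (\<forall>s\<in>L. \<forall>n. \<forall>b\<in>K. \<rho> (f s) \<sqsubset> a \<longrightarrow> s n = g b \<longrightarrow> b \<sqsubset> a)"

text \<open>
  A downward Skolem argument: each clause asks for closure under a map that assigns to parameters
  below \<open>b\<close> a small set of ranks.
\<close>

lemma elementary_club:
  "\<exists>F. (\<forall>b\<in>K. F b \<in> K) \<and> (\<forall>a\<in>closure_points F. elementary a)"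
proof -
  define between where "between u v s \<longleftrightarrow> s \<in> L \<and> (u, f s) \<in> U \<and> u \<noteq> f s \<and> (f s, v) \<in> U \<and> f s \<noteq> v" for u v s
  define pick1 where "pick1 = (\<lambda>(u, v). \<rho> (f (SOME s. between u v s)))"
  define pick2 where "pick2 = (\<lambda>(u, b). \<rho> (f (SOME s. s \<in> L \<and> \<not> separated U \<rho> b u (f s))))"
  define label where "label = (\<lambda>(u, n). inv_into K g (inv_into L f u n))"
  define low where "low b = {u \<in> Field U. \<rho> u \<sqsubseteq> b}" for b
  define fin where "fin b = {s :: nat \<Rightarrow> real. \<exists>j. (\<forall>i<j. s i \<in> g ` {x. x \<sqsubseteq> b} \<union> \<rat>) \<and> (\<forall>i\<ge>j. s i = 0)}" for b
  define R where "R b = pick1 ` (low b \<times> low b) \<union> pick2 ` (low b \<times> {x. x \<sqsubseteq> b}) \<union>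
      (\<rho> \<circ> f) ` fin b \<union> label ` (low b \<times> (UNIV :: nat set))" for b
  have "small (R b)" if b: "b \<in> K" for b
  proof -
    have "low b \<subseteq> inv_into (Field U) \<rho> ` {x. x \<sqsubseteq> b}"
      unfolding low_def using \<rho>(1) by (auto intro!: image_eqI[where x = "\<rho> _"])
    then have low: "small (low b)"
      by (rule small_mono[OF small_image[OF small_below[OF b]]])
    have "small (g ` {x. x \<sqsubseteq> b} \<union> \<rat>)"
      by (intro small_Un small_image small_below b small_countable countable_rat)
    then have fin: "small (fin b)" unfolding fin_def by (rule small_finite_sequences)
    show ?thesis unfolding R_def
      by (intro small_Un small_image small_Times low fin small_below b small_countable) simp
  qed
  then obtain F where F: "\<forall>b\<in>K. F b \<in> K"
      "\<And>a b x. a \<in> closure_points F \<Longrightarrow> b \<sqsubset> a \<Longrightarrow> x \<in> R b \<Longrightarrow> x \<in> K \<Longrightarrow> x \<sqsubset> a"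
    using closed_under_small[of R] by (metis (no_types, lifting) IntI)
  have "elementary a" if a: "a \<in> closure_points F" for a
  proof -
    have rank: "\<rho> (f s) \<in> K" if "s \<in> L" for s using \<rho>(2) f_Field[OF that] by blast
    have max: "\<exists>m. m \<sqsubset> a \<and> x \<sqsubseteq> m \<and> y \<sqsubseteq> m" if "x \<sqsubset> a" "y \<sqsubset> a" for x y
      using le_linear[of x y] le_refl[of x] le_refl[of y] le_K that by metis
    have 1: "\<exists>t\<in>L. \<rho> (f t) \<sqsubset> a \<and> (u, f t) \<in> U \<and> u \<noteq> f t \<and> (f t, v) \<in> U \<and> f t \<noteq> v"
      if asm: "u \<in> Field U" "v \<in> Field U" "s \<in> L" "\<rho> u \<sqsubset> a" "\<rho> v \<sqsubset> a"
        "(u, f s) \<in> U \<and> u \<noteq> f s \<and> (f s, v) \<in> U \<and> f s \<noteq> v" for u v s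
    proof -
      obtain m where m: "m \<sqsubset> a" "\<rho> u \<sqsubseteq> m" "\<rho> v \<sqsubseteq> m" using max[OF asm(4,5)] by blast
      define t where "t = (SOME t. between u v t)"
      have t: "between u v t"
        unfolding t_def by (rule someI[of _ s]) (use asm in \<open>simp add: between_def\<close>)
      have "pick1 (u, v) \<in> R m" unfolding R_def low_def using m asm(1,2) by blast
      moreover have "pick1 (u, v) = \<rho> (f t)" unfolding pick1_def t_def by simp
      ultimately show ?thesis using F(2)[OF a m(1)] t rank unfolding between_def by metis
    qed
    have 2: "\<exists>t\<in>L. \<rho> (f t) \<sqsubset> a \<and> \<not> separated U \<rho> b u (f t)"
      if asm: "u \<in> Field U" "s \<in> L" "\<rho> u \<sqsubset> a" "b \<sqsubset> a" "\<not> separated U \<rho> b u (f s)" for u b s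
    proof -
      obtain m where m: "m \<sqsubset> a" "\<rho> u \<sqsubseteq> m" "b \<sqsubseteq> m" using max[OF asm(3,4)] by blast
      define t where "t = (SOME t. t \<in> L \<and> \<not> separated U \<rho> b u (f t))"
      have t: "t \<in> L \<and> \<not> separated U \<rho> b u (f t)"
        unfolding t_def by (rule someI[of _ s]) (use asm in simp)
      have "pick2 (u, b) \<in> R m" unfolding R_def low_def using m asm(1) by blast
      moreover have "pick2 (u, b) = \<rho> (f t)" unfolding pick2_def t_def by simp
      ultimately show ?thesis using F(2)[OF a m(1)] t rank by metis
    qed
    have 3: "\<rho> (f s) \<sqsubset> a"
      if asm: "s \<in> L" "b \<sqsubset> a" "\<forall>i<j. s i \<in> g ` {x. x \<sqsubseteq> b}" "s j \<in> \<rat>" "\<forall>i>j. s i = 0" for s b j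
    proof -
      have "s \<in> fin b"
        unfolding fin_def using asm by (intro CollectI exI[of _ "Suc j"]) (auto simp: less_Suc_eq)
      then have "\<rho> (f s) \<in> R b" unfolding R_def by auto
      then show ?thesis using F(2)[OF a asm(2)] rank[OF asm(1)] by blast
    qed
    have 4: "b \<sqsubset> a" if asm: "s \<in> L" "b \<in> K" "\<rho> (f s) \<sqsubset> a" "s n = g b" for s n b
    proof -
      have "f s \<in> low (\<rho> (f s))" unfolding low_def using f_Field le_refl rank asm by blast
      moreover have "label (f s, n) = b"
        unfolding label_def using asm f_inj g by simp
      ultimately have "b \<in> R (\<rho> (f s))" unfolding R_def by blast
      then show ?thesis using F(2)[OF a asm(3)] asm(2) by blast
    qed
    show ?thesis unfolding elementary_def
      by (intro conjI, use 1 in blast, use 2 in blast, use 3 in blast, use 4 in blast)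
  qed
  then show ?thesis using F(1) by blast
qed


lemma elementary_between:
  assumes "elementary a" "u \<in> Field U" "v \<in> Field U" "s \<in> L" "\<rho> u \<sqsubset> a" "\<rho> v \<sqsubset> a"
    "(u, f s) \<in> U \<and> u \<noteq> f s \<and> (f s, v) \<in> U \<and> f s \<noteq> v"
  shows "\<exists>t\<in>L. \<rho> (f t) \<sqsubset> a \<and> (u, f t) \<in> U \<and> u \<noteq> f t \<and> (f t, v) \<in> U \<and> f t \<noteq> v"
  by (rule assms(1)[unfolded elementary_def, THEN conjunct1, rule_format, OF assms(2-7)])

lemma elementary_near:
  assumes "elementary a" "u \<in> Field U" "s \<in> L" "\<rho> u \<sqsubset> a" "b \<sqsubset> a" "\<not> separated U \<rho> b u (f s)"
  shows "\<exists>t\<in>L. \<rho> (f t) \<sqsubset> a \<and> \<not> separated U \<rho> b u (f t)"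
  by (rule assms(1)[unfolded elementary_def, THEN conjunct2, THEN conjunct1, rule_format, OF assms(2-6)])

lemma elementary_finite:
  assumes "elementary a" "s \<in> L" "b \<sqsubset> a" "\<And>i. i < j \<Longrightarrow> s i \<in> g ` {x. x \<sqsubseteq> b}" "s j \<in> \<rat>"
    "\<And>i. i > j \<Longrightarrow> s i = 0"
  shows "\<rho> (f s) \<sqsubset> a"
  by (rule assms(1)[unfolded elementary_def, THEN conjunct2, THEN conjunct2, THEN conjunct1,
        THEN bspec, OF assms(2), rule_format, OF assms(3) _ assms(5)])
    (auto intro: assms(4,6))

lemma elementary_label:
  assumes "elementary a" "s \<in> L" "b \<in> K" "\<rho> (f s) \<sqsubset> a" "s n = g b"
  shows "b \<sqsubset> a"
  using assms(1)[unfolded elementary_def, THEN conjunct2, THEN conjunct2, THEN conjunct2, rule_format,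
      OF assms(2-5)] .

text \<open>
  Let \<open>a = c (2 * n + 1)\<close> and \<open>b = c (2 * n + 2)\<close>.

  For \<open>n \<in> A\<close>, points of \<open>L\<close> of rank below \<open>b\<close> that agree with \<open>x\<close> up to coordinate \<open>n\<close> surround
  \<open>x\<close>.  The order \<open>U\<close> may contain extra points of rank below \<open>a\<close> in that cut, but not on both sides of
  \<open>f x\<close>: elementarity at \<open>a\<close> would put between two such points some \<open>f t\<close> of rank below \<open>a\<close>, whereas \<open>t\<close> has the label
  of \<open>a\<close> at coordinate \<open>n\<close>.  So one of the two neighbours realizes the cut of \<open>f x\<close> in \<open>U\<close>.

  For \<open>n \<notin> A\<close>, a point \<open>v\<close> of rank below \<open>b\<close> realizing the cut of \<open>f x\<close> would by elementarity at
  \<open>b\<close> yield such a point of the form \<open>f t\<close>.  Not knowing the label of \<open>b\<close>, the sequence \<open>t\<close>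
  differs from \<open>x\<close> at a coordinate \<open>j \<le> n\<close>, and a rational strictly between \<open>t j\<close> and \<open>x j\<close> gives a
  finite sequence of rank below \<open>a\<close> that separates them.
\<close>

lemma invariant_coded_point:
  fixes c :: "nat \<Rightarrow> 'k" and A :: "nat set"
  defines "x \<equiv> coded_point g c A"
  assumes c: "\<And>n. c n \<sqsubset> c (Suc n)" "\<And>n. elementary (c n)"
    and x_L: "x \<in> L" and cut_L: "\<And>j q. q \<in> \<rat> \<Longrightarrow> cut_off x j q \<in> L"
  shows "invariant U \<rho> c (f x) = A"
proof -
  have c_less: "c m \<sqsubset> c n" if "m < n" for m n
    by (rule increasing_less[of c, OF c(1) that])
  have cK: "c n \<in> K" for n using le_K(1)[OF conjunct1[OF c(1)]] .
  have c_le: "c m \<sqsubseteq> c n" if "m \<le> n" for m n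
    using that c_less[of m n] le_refl[OF cK] by (cases "m = n") auto
  have label: "x i \<in> g ` {y. y \<sqsubseteq> c k}" if "i < n" "2 * n \<le> k" for i n k
    using c_le[of "2 * i + 1" k] c_le[of "2 * i + 2" k] that
    unfolding x_def coded_point_def by auto
  have cut_rank: "\<rho> (f (cut_off x j q)) \<sqsubset> c m"
    if "q \<in> \<rat>" "k < m" "\<And>i. i < j \<Longrightarrow> x i \<in> g ` {y. y \<sqsubseteq> c k}" for j q k m
    by (rule elementary_finite[OF c(2) cut_L[OF that(1)] c_less[OF that(2)], of j])
      (use that in \<open>auto simp: cut_off_def\<close>)
  have rank_x: "\<not> \<rho> (f s) \<sqsubset> c m" if "s \<in> L" "s n = g (c m)" for s m n
    using elementary_label[OF c(2) that(1) cK _ that(2)] by blast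
  show ?thesis
  proof (intro set_eqI iffI)
    fix n assume nA: "n \<in> A"
    let ?a = "c (2 * n + 1)" and ?b = "c (2 * n + 2)"
    have x_n: "x n = g ?a" using nA by (simp add: x_def coded_point_def)
    obtain q1 q2 where q: "q1 \<in> \<rat>" "q1 < x (Suc n)" "q2 \<in> \<rat>" "x (Suc n) < q2"
      using Rats_dense_in_real[of "x (Suc n) - 1" "x (Suc n)"]
        Rats_dense_in_real[of "x (Suc n)" "x (Suc n) + 1"] by auto
    define y1 y2 where "y1 = cut_off x (Suc n) q1" and "y2 = cut_off x (Suc n) q2"
    have y_L: "y1 \<in> L" "y2 \<in> L" unfolding y1_def y2_def using cut_L q by blast+
    have "less_fun y1 x" "less_fun x y2"
      unfolding less_fun_def y1_def y2_def
      by (intro exI[of _ "Suc n"]; use q in \<open>simp add: cut_off_def\<close>)+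
    then have y: "(f y1, f x) \<in> U" "f y1 \<noteq> f x" "(f x, f y2) \<in> U" "f x \<noteq> f y2"
      using f_less_iff y_L x_L by blast+
    have labels: "x i \<in> g ` {y. y \<sqsubseteq> ?a}" if "i < Suc n" for i
    proof (cases "i = n")
      case True
      then show ?thesis using x_n le_refl[OF cK] by auto
    next
      case False
      then show ?thesis using label[of i n "2 * n + 1"] that by simp
    qed
    have rank_y: "\<rho> (f y1) \<sqsubset> ?b" "\<rho> (f y2) \<sqsubset> ?b"
      unfolding y1_def y2_def by (rule cut_rank[of _ "2 * n + 1"]; use q labels in simp)+
    have "\<not> (separated U \<rho> ?a (f x) (f y1) \<and> separated U \<rho> ?a (f x) (f y2))"
    proof
      assume sep: "separated U \<rho> ?a (f x) (f y1) \<and> separated U \<rho> ?a (f x) (f y2)"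
      have not_x: "w \<noteq> f x" if "\<rho> w \<sqsubset> ?a" for w using rank_x[of x n] x_L x_n that by blast
      obtain w1 where w1: "w1 \<in> Field U" "\<rho> w1 \<sqsubset> ?a" "(f y1, w1) \<in> U" "(w1, f x) \<in> U"
        using sep y(1,2) U_trans U_antisym unfolding separated_def by meson
      obtain w2 where w2: "w2 \<in> Field U" "\<rho> w2 \<sqsubset> ?a" "(f x, w2) \<in> U" "(w2, f y2) \<in> U"
        using sep y(3,4) U_trans U_antisym unfolding separated_def by meson
      obtain t where t: "t \<in> L" "\<rho> (f t) \<sqsubset> ?a" "(w1, f t) \<in> U" "w1 \<noteq> f t" "(f t, w2) \<in> U" "f t \<noteq> w2"
        using elementary_between[OF c(2) w1(1) w2(1) x_L w1(2) w2(2) conjI[OF w1(4) conjI[OF not_x[OF w1(2)] conjI[OF w2(3) not_x[OF w2(2), symmetric]]]]]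
        by blast
      have "(f y1, f t) \<in> U" "f y1 \<noteq> f t" "(f t, f y2) \<in> U" "f t \<noteq> f y2"
        using U_trans[OF w1(3) t(3)] U_trans[OF t(5) w2(4)] U_antisym w1(3) w2(4) t(3-6) by auto
      then have "less_fun y1 t" "less_fun t y2" using f_less_iff y_L t(1) by blast+
      then have "t n = y1 n"
        by (rule less_fun_between[of _ _ _ n]) (simp_all add: y1_def y2_def cut_off_def)
      then have "t n = g ?a" using x_n by (simp add: y1_def cut_off_def)
      then show False using rank_x[OF t(1)] t(2) by blast
    qed
    then show "n \<in> invariant U \<rho> c (f x)"
      unfolding invariant_def using rank_y y_L f_Field by blast
  next
    fix n assume n: "n \<in> invariant U \<rho> c (f x)"
    let ?a = "c (2 * n + 1)" and ?b = "c (2 * n + 2)"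
    show "n \<in> A"
    proof (rule ccontr)
      assume "n \<notin> A"
      then have x_n: "x n = g ?b" by (simp add: x_def coded_point_def)
      obtain v where v: "v \<in> Field U" "\<rho> v \<sqsubset> ?b" "\<not> separated U \<rho> ?a (f x) v"
        using n unfolding invariant_def by blast
      have ab: "?a \<sqsubset> ?b" by (rule c_less) simp
      obtain t where t: "t \<in> L" "\<rho> (f t) \<sqsubset> ?b" "\<not> separated U \<rho> ?a v (f t)"
        using elementary_near[OF c(2) v(1) x_L v(2) ab] v(3) separated_sym by metis
      have xt: "\<not> separated U \<rho> ?a (f x) (f t)"
        by (rule separated_trans[OF v(3) t(3) f_Field[OF x_L] v(1) f_Field[OF t(1)]])
      have tn: "t n \<noteq> x n" using rank_x[OF t(1), of n "2 * n + 2"] t(2) x_n by metis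
      then obtain j where j: "\<forall>i<j. t i = x i" "t j \<noteq> x j" using first_difference[of t x] by auto
      have "j \<le> n" using j(1) tn by (meson not_le)
      obtain q where q: "q \<in> \<rat>" "min (t j) (x j) < q" "q < max (t j) (x j)"
        using Rats_dense_in_real[of "min (t j) (x j)" "max (t j) (x j)"] j(2) by fastforce
      define s where "s = cut_off x j q"
      have s_L: "s \<in> L" unfolding s_def using cut_L q(1) by blast
      have "\<rho> (f s) \<sqsubset> ?a"
        unfolding s_def by (rule cut_rank[OF q(1), of "2 * n"]) (use label[of _ n] \<open>j \<le> n\<close> in simp_all)
      moreover have "less_fun t s \<and> less_fun s x \<or> less_fun x s \<and> less_fun s t"
      proof (cases "t j < x j")
        case True
        then have "less_fun t s \<and> less_fun s x"
          unfolding less_fun_def s_def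
          by (intro conjI exI[of _ j]) (use q j in \<open>simp_all add: cut_off_def\<close>)
        then show ?thesis ..
      next
        case False
        then have "less_fun x s \<and> less_fun s t"
          unfolding less_fun_def s_def
          by (intro conjI exI[of _ j]) (use q j in \<open>simp_all add: cut_off_def\<close>)
        then show ?thesis ..
      qed
      then have "(f t, f s) \<in> U \<and> (f s, f x) \<in> U \<or> (f x, f s) \<in> U \<and> (f s, f t) \<in> U"
        using f_less_iff s_L x_L t(1) by blast
      ultimately have "separated U \<rho> ?a (f x) (f t)"
        unfolding separated_def using f_Field[OF s_L] by blast
      then show False using xt by blast
    qed
  qed
qed

end

section \<open>Nonexistence of a universal order\<close>

theorem mainTheorem9:
  fixes \<kappa> :: "'k rel"
  assumes "Card_order \<kappa>" and "regularCard \<kappa>"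
    and "cardSuc natLeq <o \<kappa>"
    and "\<kappa> <o ctwo ^c natLeq"
  shows "\<not> (\<exists>U :: 'u rel. universal_linear_order \<kappa> U)"
proof
  assume "\<exists>U :: 'u rel. universal_linear_order \<kappa> U"
  then obtain U :: "'u rel" where univ: "universal_linear_order \<kappa> U" ..
  interpret regular_uncountable \<kappa>
    by (rule regular_uncountable.intro[OF assms(1,2)
          ordLess_transitive[OF cardSuc_greater[OF natLeq_Card_order] assms(3)]])
  have U: "Linear_order U" "|Field U| =o \<kappa>" using univ unfolding universal_linear_order_def by blast+
  have K: "|K| =o \<kappa>" by (rule card_of_Field_ordIso[OF card])
  have "|Field U| \<le>o |K|"
    by (rule ordIso_imp_ordLeq[OF ordIso_transitive[OF U(2) ordIso_symmetric[OF K]]])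
  then obtain \<rho> where \<rho>: "inj_on \<rho> (Field U)" "\<rho> ` Field U \<subseteq> K"
    using card_of_ordLeq[of "Field U" K] by blast
  have "ctwo ^c natLeq =o |UNIV :: nat set set|"
    using card_of_Pow_Func[of "UNIV :: nat set"] ordIso_symmetric
    unfolding cexp_def ctwo_def Field_card_of Field_natLeq by simp
  then have continuum: "\<kappa> <o |UNIV :: nat set set|" using assms(4) ordLess_ordIso_trans by blast
  have "|K| \<le>o |UNIV :: nat set set|"
    using K continuum ordIso_ordLess_trans ordLess_imp_ordLeq by blast
  then obtain h :: "'k \<Rightarrow> nat set" where h: "inj_on h K"
    using card_of_ordLeq[of K "UNIV :: nat set set"] by blast
  obtain r :: "nat set \<Rightarrow> real" where r: "inj r"
    using nat_sets_eqpoll_reals unfolding eqpoll_def bij_betw_def by blast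
  define g where "g = r \<circ> h"
  have g: "inj_on g K" unfolding g_def using h r by (simp add: comp_inj_on inj_on_subset)
  \<comment> \<open>The guessing sequences are fixed before the set to be coded and before the embedding.\<close>
  obtain c where c: "\<And>F. \<forall>b\<in>K. F b \<in> K \<Longrightarrow>
      \<exists>d\<in>K. range (c d) \<subseteq> closure_points F \<and> (\<forall>n::nat. c d n \<sqsubset> c d (Suc n))"
    using omega_club_guessing[OF assms(3)] by blast

  have "|Field U \<times> K| \<le>o \<kappa>"
    by (rule card_of_Times_ordLeq_infinite_Field[OF infinite_K ordIso_imp_ordLeq[OF U(2)] ordIso_imp_ordLeq[OF K] card])
  then have "|(\<lambda>(u, d). invariant U \<rho> (c d) u) ` (Field U \<times> K)| <o |UNIV :: nat set set|"
    by (rule ordLeq_ordLess_trans[OF ordLeq_transitive[OF card_of_image] continuum])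
  then have "(\<lambda>(u, d). invariant U \<rho> (c d) u) ` (Field U \<times> K) \<noteq> UNIV"
    using ordLess_irreflexive by metis
  then obtain A where A: "A \<notin> (\<lambda>(u, d). invariant U \<rho> (c d) u) ` (Field U \<times> K)" by blast

  \<comment> \<open>One candidate for every guess, since the right \<open>d\<close> depends on the embedding, which depends on \<open>L\<close>.\<close>
  define x where "x d = coded_point g (c d) A" for d
  define L where "L = x ` K \<union> (\<lambda>(d, j, q). cut_off (x d) j (of_rat q)) ` (K \<times> (UNIV :: (nat \<times> rat) set))"
  have "|K \<times> (UNIV :: (nat \<times> rat) set)| \<le>o \<kappa>"
    by (rule card_of_Times_ordLeq_infinite_Field[OF infinite_K ordIso_imp_ordLeq[OF K]
          ordLess_imp_ordLeq[OF small_countable] card]) simp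
  then have "|L| \<le>o \<kappa>"
    unfolding L_def
    by (intro card_of_Un_ordLeq_infinite_Field[OF infinite_K _ _ card] ordLeq_transitive[OF card_of_image]
        ordIso_imp_ordLeq[OF K])
  then obtain f where f: "order_embedding (lex_on L) U f"
    using universal_linear_order_embeds[OF card univ Linear_order_lex_on] unfolding Field_lex_on by blast
  interpret ranked_embedding \<kappa> U \<rho> g L f
    using U(1) \<rho> g f by unfold_locales
  obtain F where F: "\<forall>b\<in>K. F b \<in> K" "\<forall>a\<in>closure_points F. elementary a"
    using elementary_club by blast
  obtain d where d: "d \<in> K" "range (c d) \<subseteq> closure_points F" "\<And>n. c d n \<sqsubset> c d (Suc n)"
    using c[OF F(1)] by blast
  have x_L: "x d \<in> L" unfolding L_def using d(1) by blast
  have cut_L: "cut_off (x d) j q \<in> L" if q: "q \<in> \<rat>" for j q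
  proof -
    obtain p where p: "q = of_rat p" using q by (rule Rats_cases)
    have "(d, j, p) \<in> K \<times> UNIV" using d(1) by simp
    then show ?thesis unfolding L_def p by (intro UnI2 image_eqI[of _ _ "(d, j, p)"]) simp_all
  qed
  have "invariant U \<rho> (c d) (f (x d)) = A"
  proof (rule invariant_coded_point[of "c d" A, folded x_def])
    show "c d n \<sqsubset> c d (Suc n)" for n by (rule d(3))
    show "elementary (c d n)" for n using d(2) F(2) by blast
    show "x d \<in> L" by (rule x_L)
    show "cut_off (x d) j q \<in> L" if "q \<in> \<rat>" for j q using that by (rule cut_L)
  qed
  then show False using A f_Field[OF x_L] d(1) by blast
qed

end
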